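(* Let $R$ be a refinement ring with the following property: for all finitely generated projective $R$-modules $A,B$ with $B$ a generator, $2R\oplus A\cong R\oplus B$ implies $R\oplus A\cong B$. Then every regular square matrix over $R$ admits a diagonal reduction.
   Context: Modules are right modules. A ring $R$ is a refinement ring if the monoid $V(R)$ of isomorphism classes of finitely generated projective $R$-modules (under direct sum) has the refinement property: whenever $x_1+x_2=y_1+y_2$ in $V(R)$, there exist $z_{ij}\in V(R)$ with $x_i=z_{i1}+z_{i2}$ and $y_j=z_{1j}+z_{2j}$. $2R=R\oplus R$. A matrix $f\in M_{m\times n}(R)$ is regular if there is $g\in M_{n\times m}(R)$ with $fgf=f$. A matrix $A$ admits a diagonal reduction if there exist invertible matrices $P,Q$ with $PAQ$ diagonal (all entries $a_{ij}$ with $i\ne j$ equal to $0$). *)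

theory Defs
  imports "Jordan_Normal_Form.Matrix"
begin

(* Finitely generated projective right R-modules are modelled, up to isomorphism,
   by idempotent square matrices e (the module e R^n); this is the standard
   description of V(R) (e.g. Goodearl, von Neumann Regular Rings, Ch. 15). *)

definition idem_mat :: "'a::ring_1 mat \<Rightarrow> bool" where
  "idem_mat e \<longleftrightarrow> square_mat e \<and> e * e = e"

(* isomorphism of the modules e R^n and f R^m (Murray-von Neumann equivalence) *)
definition proj_iso :: "'a::ring_1 mat \<Rightarrow> 'a mat \<Rightarrow> bool" where
  "proj_iso e f \<longleftrightarrow>
     (\<exists>x y. x \<in> carrier_mat (dim_row f) (dim_row e) \<and>
            y \<in> carrier_mat (dim_row e) (dim_row f) \<and>
            x = f * x * e \<and> y = e * y * f \<and> y * x = e \<and> x * y = f)"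

definition dsum :: "'a::ring_1 mat \<Rightarrow> 'a mat \<Rightarrow> 'a mat" where
  "dsum e f = four_block_mat e (0\<^sub>m (dim_row e) (dim_col f)) (0\<^sub>m (dim_row f) (dim_col e)) f"

fun dpow :: "'a::ring_1 mat \<Rightarrow> nat \<Rightarrow> 'a mat" where
  "dpow e 0 = 1\<^sub>m 0"
| "dpow e (Suc k) = dsum e (dpow e k)"

abbreviation free_mod :: "nat \<Rightarrow> 'a::ring_1 mat" where
  "free_mod n \<equiv> 1\<^sub>m n"

definition is_generator :: "'a::ring_1 mat \<Rightarrow> bool" where
  "is_generator b \<longleftrightarrow>
     (\<exists>k c. idem_mat c \<and> proj_iso (dsum (free_mod 1) c) (dpow b k))"

definition refinement_ring :: "'a::ring_1 itself \<Rightarrow> bool" where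
  "refinement_ring TYPE('a) \<longleftrightarrow>
     (\<forall>x1 x2 y1 y2 :: 'a mat.
        idem_mat x1 \<and> idem_mat x2 \<and> idem_mat y1 \<and> idem_mat y2 \<and>
        proj_iso (dsum x1 x2) (dsum y1 y2) \<longrightarrow>
        (\<exists>z11 z12 z21 z22. idem_mat z11 \<and> idem_mat z12 \<and> idem_mat z21 \<and> idem_mat z22 \<and>
           proj_iso x1 (dsum z11 z12) \<and> proj_iso x2 (dsum z21 z22) \<and>
           proj_iso y1 (dsum z11 z21) \<and> proj_iso y2 (dsum z12 z22)))"

definition regular_mat :: "'a::ring_1 mat \<Rightarrow> bool" where
  "regular_mat f \<longleftrightarrow> (\<exists>g \<in> carrier_mat (dim_col f) (dim_row f). f * g * f = f)"

definition admits_diagonal_reduction :: "'a::ring_1 mat \<Rightarrow> bool" where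
  "admits_diagonal_reduction A \<longleftrightarrow>
     (\<exists>P Q. P \<in> carrier_mat (dim_row A) (dim_row A) \<and> Q \<in> carrier_mat (dim_col A) (dim_col A) \<and>
        invertible_mat P \<and> invertible_mat Q \<and> diagonal_mat (P * A * Q))"

end

theory Submission
  imports Defs
begin

text \<open>Write \<open>u\<close> for the class of \<open>R\<close> in \<open>V(R)\<close> and \<open>k, i, c\<close> for the classes of the kernel, image
  and cokernel of a regular matrix, so that \<open>n u = k + i = i + c\<close>. Two regular matrices with the
  same \<open>k, i, c\<close> are equivalent, so it suffices to decompose \<open>k = \<Sum>k\<^sub>j\<close>, \<open>i = \<Sum>i\<^sub>j\<close>, \<open>c = \<Sum>c\<^sub>j\<close>
  with \<open>k\<^sub>j + i\<^sub>j = u = i\<^sub>j + c\<^sub>j\<close>. By refinement one can split \<open>u = k\<^sub>1 + i\<^sub>1\<close> and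
  \<open>(n - 1) u = k' + i'\<close> with \<open>i\<close> below a multiple of \<open>i\<^sub>1\<close>. Then \<open>c + i\<^sub>1\<close> is a generator and
  \<open>n u + k' = (n - 1) u + c + i\<^sub>1\<close>, so the cancellation hypothesis gives \<open>u + k' = c + i\<^sub>1\<close>.
  Refining this as \<open>u = c\<^sub>1 + e\<^sub>1\<close>, \<open>k' = c' + e'\<close>, \<open>c = c\<^sub>1 + c'\<close>, \<open>i\<^sub>1 = e\<^sub>1 + e'\<close>, the first diagonal
  entry takes kernel \<open>k\<^sub>1 + e'\<close>, image \<open>e\<^sub>1\<close> and cokernel \<open>c\<^sub>1\<close>; what remains has kernel and
  cokernel both equal to \<open>c'\<close> and therefore splits by plain refinement.\<close>

section \<open>Refinement monoids\<close>

primrec nat_mult :: "nat \<Rightarrow> 'm::comm_monoid_add \<Rightarrow> 'm" where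
  "nat_mult 0 u = 0"
| "nat_mult (Suc n) u = u + nat_mult n u"

lemma nat_mult_add: "nat_mult n (a + b) = nat_mult n a + nat_mult n b"
  by (induction n) (simp_all add: ac_simps)

text \<open>Each summand \<open>(k1, i1, c1)\<close> has the shape of the kernel, image and cokernel
  classes of a regular element of R, that is, of a single diagonal entry.\<close>

primrec splits_diagonally :: "nat \<Rightarrow> 'm::comm_monoid_add \<Rightarrow> 'm \<Rightarrow> 'm \<Rightarrow> 'm \<Rightarrow> bool" where
  "splits_diagonally 0 u k i c \<longleftrightarrow> k = 0 \<and> i = 0 \<and> c = 0"
| "splits_diagonally (Suc n) u k i c \<longleftrightarrow>
     (\<exists>k1 i1 c1 k' i' c'. u = k1 + i1 \<and> u = i1 + c1 \<and> k = k1 + k' \<and> i = i1 + i' \<and> c = c1 + c' \<and>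
        splits_diagonally n u k' i' c')"

text \<open>These are the properties of V(R) used below, with \<open>u\<close> the class of R. The
  premise \<open>u + e = nat_mult k b\<close> of \<open>cancel_unit\<close> makes R a direct summand
  of a multiple of B, so it encodes that B is a generator.\<close>

locale refinement_monoid =
  fixes u :: "'m::comm_monoid_add"
  assumes refinement: "a + b = c + d \<Longrightarrow>
      \<exists>z11 z12 z21 z22. a = z11 + z12 \<and> b = z21 + z22 \<and> c = z11 + z21 \<and> d = z12 + z22"
    and conical: "a + b = 0 \<Longrightarrow> a = (0::'m)"
    and cancel_unit: "u + e = nat_mult k b \<Longrightarrow> u + (u + a) = u + b \<Longrightarrow> u + a = b"
begin

text \<open>The copies of \<open>u\<close> are cancelled one at a time: \<open>cancel_unit\<close>
  is applied with \<open>nat_mult m u\<close> added to both \<open>a\<close> and \<open>b\<close>.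
  The enlarged \<open>b\<close> is still a generator, because its \<open>k\<close>-fold multiple
  contains that of \<open>b\<close>.\<close>

lemma cancel_multiple:
  assumes "u + e = nat_mult k b" "nat_mult m u + (u + a) = nat_mult m u + b"
  shows "u + a = b"
  using assms(2)
proof (induction m)
  case (Suc m)
  have "u + (e + nat_mult k (nat_mult m u)) = nat_mult k (nat_mult m u + b)"
    by (simp add: nat_mult_add assms(1)[symmetric] ac_simps)
  moreover have "u + (u + (nat_mult m u + a)) = u + (nat_mult m u + b)"
    using Suc.prems by (simp add: ac_simps)
  ultimately have "u + (nat_mult m u + a) = nat_mult m u + b"
    by (rule cancel_unit)
  then show ?case
    by (intro Suc.IH) (simp add: ac_simps)
qed simp

text \<open>If kernel and cokernel have the same class, one refinement serves both conditions on
  each entry, so copies of \<open>u\<close> can be split off without any cancellation. Conicality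
  settles the empty sum.\<close>

lemma splits_diagonally_if_sum:
  "nat_mult n u = k + i \<Longrightarrow> splits_diagonally n u k i k"
proof (induction n arbitrary: k i)
  case 0
  then show ?case using conical[of k i] conical[of i k] by (auto simp: add.commute)
next
  case (Suc n)
  then have "u + nat_mult n u = k + i" by simp
  then obtain k1 i1 k' i' where "u = k1 + i1" "nat_mult n u = k' + i'" "k = k1 + k'" "i = i1 + i'"
    using refinement by blast
  moreover from this have "u = i1 + k1" "splits_diagonally n u k' i' k'"
    using Suc.IH by (simp_all add: add.commute)
  ultimately show ?case unfolding splits_diagonally.simps by blast
qed

text \<open>Refining two of the summands against each other moves all of \<open>i\<close>, up to multiplicity, into
  a single summand.\<close>

lemma split_with_dominant_summand:
  assumes "nat_mult (Suc n) u = k + i"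
  shows "\<exists>k1 i1 k' i' N d. u = k1 + i1 \<and> nat_mult n u = k' + i' \<and> k = k1 + k' \<and> i = i1 + i' \<and>
    i' + d = nat_mult N i1"
  using assms
proof (induction n arbitrary: k i)
  case 0
  then have "u = k + i" "nat_mult 0 u = 0 + 0" "k = k + 0" "i = i + 0" "0 + 0 = nat_mult 0 i"
    by simp_all
  then show ?case by blast
next
  case (Suc n)
  then have "u + nat_mult (Suc n) u = k + i" by simp
  then obtain b a k0 i0 where ab: "u = b + a" and n0: "nat_mult (Suc n) u = k0 + i0"
    and k: "k = b + k0" and i: "i = a + i0"
    using refinement by blast
  obtain k1 i1 k' i' N d where 1: "u = k1 + i1" "nat_mult n u = k' + i'" "k0 = k1 + k'"
    "i0 = i1 + i'" "i' + d = nat_mult N i1"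
    using Suc.IH[OF n0] by blast
  \<comment> \<open>Two copies of \<open>u\<close> are compared: \<open>b + a\<close>, just split
    off, and \<open>k1 + i1\<close>, dominant so far. The piece \<open>v\<close>, common to
    \<open>a\<close> and \<open>k1\<close>, is made image in the dominant copy and kernel in the
    other one. The dominant copy becomes \<open>w + (i1 + v)\<close>, and the other keeps only
    \<open>s\<close> as image.\<close>
  have "a + b = i1 + k1" using ab 1(1) by (simp add: add.commute)
  then obtain s v t w where r: "a = s + v" "b = t + w" "i1 = s + t" "k1 = v + w"
    using refinement by blast
  have e1: "u = w + (i1 + v)" using 1(1) r by (simp add: ac_simps)
  have e2: "nat_mult (Suc n) u = (k' + (t + w + v)) + (i' + s)"
    using 1(2) ab r by (simp add: ac_simps)
  have e3: "k = w + (k' + (t + w + v))" using k 1(3) r by (simp add: ac_simps)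
  have e4: "i = (i1 + v) + (i' + s)" using i 1(4) r by (simp add: ac_simps)
  \<comment> \<open>Since \<open>s\<close> is a summand of \<open>i1\<close>, one more multiple of
    the dominant image suffices to absorb it.\<close>
  have e5: "(i' + s) + (d + t + v + nat_mult N v) = nat_mult (Suc N) (i1 + v)"
    unfolding nat_mult_add nat_mult.simps 1(5)[symmetric] by (simp add: r(3) ac_simps)
  from e1 e2 e3 e4 e5 show ?case by blast
qed

proposition splits_diagonally:
  assumes k: "nat_mult (Suc n) u = k + i" and c: "nat_mult (Suc n) u = i + c"
  shows "splits_diagonally (Suc n) u k i c"
proof -
  obtain k1 i1 k' i' N d where 1: "u = k1 + i1" "nat_mult n u = k' + i'" "k = k1 + k'"
    "i = i1 + i'" "i' + d = nat_mult N i1"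
    using split_with_dominant_summand[OF k] by blast
  \<comment> \<open>Proof that \<open>c + i1\<close> is a generator:
    \<open>nat_mult (Suc n) u\<close> equals \<open>c + i1 + i'\<close>, adding \<open>d\<close>
    turns \<open>i'\<close> into \<open>nat_mult N i1\<close>, and \<open>N\<close> further copies
    of \<open>c\<close> complete the multiple.\<close>
  have "u + (nat_mult n u + d + nat_mult N c) = nat_mult (Suc n) u + d + nat_mult N c"
    by (simp add: ac_simps)
  also have "\<dots> = nat_mult (Suc N) (c + i1)"
    using c 1(4) 1(5)[symmetric] by (simp add: nat_mult_add ac_simps)
  finally have unit: "u + (nat_mult n u + d + nat_mult N c) = nat_mult (Suc N) (c + i1)" .
  have "nat_mult n u + (u + k') = nat_mult (Suc n) u + k'" by (simp add: ac_simps)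
  also have "\<dots> = nat_mult n u + (c + i1)" unfolding c 1(2) 1(4) by (simp add: ac_simps)
  finally have "u + k' = c + i1" using unit cancel_multiple by blast
  then obtain c1 e1 c' e' where r: "u = c1 + e1" "k' = c' + e'" "c = c1 + c'" "i1 = e1 + e'"
    using refinement by blast
  \<comment> \<open>The piece \<open>e'\<close> lies in both \<open>k'\<close> and
    \<open>i1\<close>. It is exchanged: it becomes kernel in the first copy of \<open>u\<close> and
    image in the remaining \<open>n\<close> copies, which leaves \<open>c'\<close> as both kernel
    and cokernel there.\<close>
  have "nat_mult n u = c' + (i' + e')" using 1(2) r(2) by (simp add: ac_simps)
  then have "splits_diagonally n u c' (i' + e') c'" by (rule splits_diagonally_if_sum)
  moreover have "u = (k1 + e') + e1" using 1(1) r(4) by (simp add: ac_simps)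
  moreover have "u = e1 + c1" using r(1) by (simp add: ac_simps)
  moreover have "k = (k1 + e') + c'" using 1(3) r(2) by (simp add: ac_simps)
  moreover have "i = e1 + (i' + e')" using 1(4) r(4) by (simp add: ac_simps)
  ultimately show ?thesis using r(3) unfolding splits_diagonally.simps by blast
qed

end

section \<open>Idempotent matrices\<close>

lemma mult_mat_assoc:
  "dim_col A = dim_row B \<Longrightarrow> dim_col B = dim_row C \<Longrightarrow> (A * B) * C = A * (B * (C :: 'a::semiring_0 mat))"
  by (rule assoc_mult_mat[of _ "dim_row A" "dim_col A" _ "dim_col B" _ "dim_col C"]) auto

lemma dsum_dim [simp]:
  "dim_row (dsum a b) = dim_row a + dim_row b" "dim_col (dsum a b) = dim_col a + dim_col b"
  by (simp_all add: dsum_def)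

lemma dsum_mult:
  fixes a b c d :: "'a::ring_1 mat"
  assumes "dim_col a = dim_row c" "dim_col b = dim_row d"
  shows "dsum a b * dsum c d = dsum (a * c) (b * d)"
  unfolding dsum_def
  by (subst mult_four_block_mat[of _ "dim_row a" "dim_col a" _ "dim_col b" _ "dim_row b"
        _ _ "dim_col c" _ "dim_col d"])
     (use assms in \<open>auto intro!: arg_cong2[where f = "\<lambda>x y. four_block_mat x _ _ y"]\<close>)

lemma dsum_assoc: "dsum (dsum a b) c = dsum a (dsum b c)"
  unfolding dsum_def using assoc_four_block_mat[of a b c] by simp

lemma dsum_one: "dsum (1\<^sub>m a) (1\<^sub>m b) = 1\<^sub>m (a + b)"
  by (simp add: dsum_def)

lemma dsum_add:
  assumes "dim_row a = dim_row c" "dim_col a = dim_col c" "dim_row b = dim_row d" "dim_col b = dim_col d"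
  shows "dsum a b + dsum c d = dsum (a + c) (b + d)"
  using assms by (intro eq_matI) (auto simp: dsum_def)

lemma dsum_minus:
  assumes "dim_row a = dim_row c" "dim_col a = dim_col c" "dim_row b = dim_row d" "dim_col b = dim_col d"
  shows "dsum a b - dsum c d = dsum (a - c) (b - d)"
  using assms by (intro eq_matI) (auto simp: dsum_def)

lemma dsum_diagonal:
  assumes "diagonal_mat a" "diagonal_mat b" "square_mat a"
  shows "diagonal_mat (dsum a b)"
  using assms by (auto simp: diagonal_mat_def dsum_def)

lemma dsum_empty: "dsum (1\<^sub>m 0) a = a"
  by (intro eq_matI) (auto simp: dsum_def)

lemma idem_matD: "idem_mat e \<Longrightarrow> dim_col e = dim_row e" "idem_mat e \<Longrightarrow> e * e = e"
  by (auto simp: idem_mat_def)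

lemma idem_mult_assoc:
  "idem_mat e \<Longrightarrow> dim_row x = dim_row e \<Longrightarrow> e * (e * x) = e * x"
  by (simp add: mult_mat_assoc[symmetric] idem_matD)

lemma idem_one: "idem_mat (1\<^sub>m n)"
  by (simp add: idem_mat_def)

lemma idem_dsum: "idem_mat a \<Longrightarrow> idem_mat b \<Longrightarrow> idem_mat (dsum a b)"
  by (auto simp: idem_mat_def dsum_mult)

lemma idem_dpow: "idem_mat a \<Longrightarrow> idem_mat (dpow a n)"
  by (induction n) (auto intro: idem_one idem_dsum)

lemma idem_complement:
  assumes "idem_mat (e :: 'a::ring_1 mat)" "e \<in> carrier_mat n n"
  shows "e * (1\<^sub>m n - e) = 0\<^sub>m n n" "(1\<^sub>m n - e) * e = 0\<^sub>m n n" "idem_mat (1\<^sub>m n - e)"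
proof -
  have 0: "e - e = 0\<^sub>m n n" using assms by (intro eq_matI) auto
  show 1: "e * (1\<^sub>m n - e) = 0\<^sub>m n n"
    using assms 0 by (subst mult_minus_distrib_mat[of _ n n _ n]) (auto simp: idem_matD)
  show "(1\<^sub>m n - e) * e = 0\<^sub>m n n"
    using assms 0 by (subst minus_mult_distrib_mat[of _ n n _ _ n]) (auto simp: idem_matD)
  have "(1\<^sub>m n - e) * (1\<^sub>m n - e) = 1\<^sub>m n * (1\<^sub>m n - e) - e * (1\<^sub>m n - e)"
    using assms by (intro minus_mult_distrib_mat) auto
  also have "\<dots> = 1\<^sub>m n - e" using assms unfolding 1 by (intro eq_matI) auto
  finally show "idem_mat (1\<^sub>m n - e)" using assms by (simp add: idem_mat_def)
qed

text \<open>The normalization in \<open>proj_iso\<close> comes for free: associativity gives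
  \<open>f * x = x * e\<close> and \<open>e * y = y * f\<close>, so \<open>x * e\<close> and
  \<open>y * f\<close> are normalized and still mutually inverse.\<close>

lemma proj_isoI:
  assumes e: "idem_mat (e :: 'a::ring_1 mat)" and f: "idem_mat f"
    and x: "x \<in> carrier_mat (dim_row f) (dim_row e)" and y: "y \<in> carrier_mat (dim_row e) (dim_row f)"
    and yx: "y * x = e" and xy: "x * y = f"
  shows "proj_iso e f"
proof -
  note d = idem_matD[OF e] idem_matD[OF f]
  have dx: "dim_row x = dim_row f" "dim_col x = dim_row e" "dim_row y = dim_row e" "dim_col y = dim_row f"
    using x y by auto
  have fx: "f * x = x * e" and ey: "e * y = y * f"
    using mult_mat_assoc[of x y x] mult_mat_assoc[of y x y] by (simp_all add: yx xy dx)
  show ?thesis unfolding proj_iso_def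
  proof (intro exI conjI)
    show "x * e \<in> carrier_mat (dim_row f) (dim_row e)" "y * f \<in> carrier_mat (dim_row e) (dim_row f)"
      using x y d by auto
    show "x * e = f * (x * e) * e"
      by (simp add: mult_mat_assoc[symmetric] dx d fx) (simp add: mult_mat_assoc dx d)
    show "y * f = e * (y * f) * f"
      by (simp add: mult_mat_assoc[symmetric] dx d ey) (simp add: mult_mat_assoc dx d)
    have "y * f * (x * e) = y * (f * x) * e" by (simp add: mult_mat_assoc dx d)
    also have "\<dots> = (y * x) * (e * e)" by (simp add: mult_mat_assoc dx d fx)
    finally show "y * f * (x * e) = e" by (simp add: yx d)
    have "x * e * (y * f) = x * (e * y) * f" by (simp add: mult_mat_assoc dx d)
    also have "\<dots> = (x * y) * (f * f)" by (simp add: mult_mat_assoc dx d ey)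
    finally show "x * e * (y * f) = f" by (simp add: xy d)
  qed
qed

lemma proj_isoE:
  assumes "proj_iso e f" and e: "idem_mat (e :: 'a::ring_1 mat)" and f: "idem_mat f"
    and de: "dim_row e = m" and df: "dim_row f = n"
  obtains x y where "x \<in> carrier_mat n m" "y \<in> carrier_mat m n"
    "y * x = e" "x * y = f" "f * x = x" "x * e = x" "e * y = y" "y * f = y"
proof -
  obtain x y where xy: "x \<in> carrier_mat (dim_row f) (dim_row e)" "y \<in> carrier_mat (dim_row e) (dim_row f)"
    "x = f * x * e" "y = e * y * f" "y * x = e" "x * y = f"
    using assms unfolding proj_iso_def by blast
  note d = idem_matD[OF e] idem_matD[OF f]
  have dx: "dim_row x = dim_row f" "dim_col x = dim_row e" "dim_row y = dim_row e" "dim_col y = dim_row f"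
    using xy by auto
  have "f * x = f * (f * x * e)" using xy(3) by simp
  also have "\<dots> = f * x * e" by (simp add: mult_mat_assoc dx d idem_mult_assoc f)
  finally have 1: "f * x = x" using xy(3) by simp
  have "x * e = (f * x * e) * e" using xy(3) by simp
  also have "\<dots> = f * x * e" by (simp add: mult_mat_assoc dx d)
  finally have 2: "x * e = x" using xy(3) by simp
  have "e * y = e * (e * y * f)" using xy(4) by simp
  also have "\<dots> = e * y * f" by (simp add: mult_mat_assoc dx d idem_mult_assoc e)
  finally have 3: "e * y = y" using xy(4) by simp
  have "y * f = (e * y * f) * f" using xy(4) by simp
  also have "\<dots> = e * y * f" by (simp add: mult_mat_assoc dx d)
  finally have 4: "y * f = y" using xy(4) by simp
  show ?thesis by (rule that) (fact xy(1,2)[unfolded de df] xy 1 2 3 4)+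
qed

lemma proj_iso_refl:
  assumes "idem_mat e"
  shows "proj_iso e e"
proof -
  have "e \<in> carrier_mat (dim_row e) (dim_row e)"
    using idem_matD(1)[OF assms] by (rule carrier_matI[OF refl])
  then show ?thesis using assms idem_matD(2)[OF assms] by (intro proj_isoI)
qed

lemma proj_iso_sym: "proj_iso e f \<Longrightarrow> proj_iso f e"
  unfolding proj_iso_def by (elim exE conjE, intro exI conjI; assumption)

lemma proj_iso_trans:
  assumes "proj_iso e f" "proj_iso f g" and i: "idem_mat (e :: 'a::ring_1 mat)" "idem_mat f" "idem_mat g"
  shows "proj_iso e g"
proof -
  obtain x y where 1: "x \<in> carrier_mat (dim_row f) (dim_row e)" "y \<in> carrier_mat (dim_row e) (dim_row f)"
    "y * x = e" "x * y = f" "f * x = x" "y * f = y"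
    by (rule proj_isoE[OF assms(1) i(1,2) refl refl]) (rule that; assumption)
  obtain v w where 2: "v \<in> carrier_mat (dim_row g) (dim_row f)" "w \<in> carrier_mat (dim_row f) (dim_row g)"
    "w * v = f" "v * w = g" "v * f = v"
    by (rule proj_isoE[OF assms(2) i(2,3) refl refl]) (rule that; assumption)
  have d: "dim_row x = dim_row f" "dim_col x = dim_row e" "dim_row y = dim_row e" "dim_col y = dim_row f"
    "dim_row v = dim_row g" "dim_col v = dim_row f" "dim_row w = dim_row f" "dim_col w = dim_row g"
    using 1(1,2) 2(1,2) by auto
  show ?thesis
  proof (rule proj_isoI[OF i(1) i(3), of "v * x" "y * w"])
    have "(y * w) * (v * x) = y * ((w * v) * x)" by (simp add: mult_mat_assoc d)
    then show "(y * w) * (v * x) = e" by (simp add: 1 2)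
    have "(v * x) * (y * w) = v * (x * y) * w" by (simp add: mult_mat_assoc d)
    then show "(v * x) * (y * w) = g" by (simp add: 1 2)
  qed (rule carrier_matI; simp add: d)+
qed

lemma proj_iso_dsum:
  assumes "proj_iso e f" "proj_iso e' f'"
    and i: "idem_mat (e :: 'a::ring_1 mat)" "idem_mat f" "idem_mat e'" "idem_mat f'"
  shows "proj_iso (dsum e e') (dsum f f')"
proof -
  obtain x y where 1: "x \<in> carrier_mat (dim_row f) (dim_row e)" "y \<in> carrier_mat (dim_row e) (dim_row f)"
    "y * x = e" "x * y = f"
    by (rule proj_isoE[OF assms(1) i(1,2) refl refl]) (rule that; assumption)
  obtain v w where 2: "v \<in> carrier_mat (dim_row f') (dim_row e')" "w \<in> carrier_mat (dim_row e') (dim_row f')"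
    "w * v = e'" "v * w = f'"
    by (rule proj_isoE[OF assms(2) i(3,4) refl refl]) (rule that; assumption)
  have d: "dim_row x = dim_row f" "dim_col x = dim_row e" "dim_row y = dim_row e" "dim_col y = dim_row f"
    "dim_row v = dim_row f'" "dim_col v = dim_row e'" "dim_row w = dim_row e'" "dim_col w = dim_row f'"
    using 1(1,2) 2(1,2) by auto
  show ?thesis
  proof (rule proj_isoI[of _ _ "dsum x v" "dsum y w"])
    show "dsum y w * dsum x v = dsum e e'" "dsum x v * dsum y w = dsum f f'"
      by (simp_all add: dsum_mult d 1(3,4) 2(3,4))
  qed (simp_all add: idem_dsum i, (rule carrier_matI; simp add: d idem_matD i)+)
qed

lemma proj_iso_dsum_commute:
  assumes "idem_mat (e :: 'a::ring_1 mat)" "idem_mat f"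
  shows "proj_iso (dsum e f) (dsum f e)"
proof -
  obtain m n where c: "e \<in> carrier_mat m m" "f \<in> carrier_mat n n"
    using assms by (auto simp: idem_mat_def)
  \<comment> \<open>The coordinate swap, cut down to the two summands by the idempotents
    themselves.\<close>
  let ?x = "four_block_mat (0\<^sub>m n m) f e (0\<^sub>m m n)"
  let ?y = "four_block_mat (0\<^sub>m m n) e f (0\<^sub>m n m)"
  have x: "?x \<in> carrier_mat (n + m) (m + n)" and y: "?y \<in> carrier_mat (m + n) (n + m)"
    using c by simp_all
  have yx: "?y * ?x = dsum e f" unfolding dsum_def
    using c assms
    by (subst mult_four_block_mat[of _ m n _ m _ n _ _ m _ n]) (simp_all add: idem_matD)
  have xy: "?x * ?y = dsum f e" unfolding dsum_def
    using c assms
    by (subst mult_four_block_mat[of _ n m _ n _ m _ _ n _ m]) (simp_all add: idem_matD)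
  show ?thesis
    by (rule proj_isoI[OF _ _ _ _ yx xy]) (use assms c in \<open>simp_all add: idem_dsum\<close>)
qed

section \<open>The monoid of isomorphism classes\<close>

text \<open>Only idempotent matrices represent modules, so the relation is a partial equivalence.
  Its quotient \<open>proj_class\<close> is V(R), with addition induced by
  \<open>dsum\<close>.\<close>

definition idem_iso :: "'a::ring_1 mat \<Rightarrow> 'a mat \<Rightarrow> bool" where
  "idem_iso e f \<longleftrightarrow> idem_mat e \<and> idem_mat f \<and> proj_iso e f"

quotient_type (overloaded) 'a proj_class = "'a::ring_1 mat" / partial: idem_iso
proof (rule part_equivpI)
  show "\<exists>x :: 'a mat. idem_iso x x" 
    by (rule exI[of _ "1\<^sub>m 0"]) (simp add: idem_iso_def idem_one proj_iso_refl)
  show "symp (idem_iso :: 'a mat \<Rightarrow> _)" by (auto simp: symp_def idem_iso_def proj_iso_sym)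
  show "transp (idem_iso :: 'a mat \<Rightarrow> _)" unfolding transp_def idem_iso_def
    using proj_iso_trans by blast
qed

instantiation proj_class :: (ring_1) comm_monoid_add
begin

lift_definition zero_proj_class :: "'a proj_class" is "1\<^sub>m 0"
  by (simp add: idem_iso_def idem_one proj_iso_refl)

lift_definition plus_proj_class :: "'a proj_class \<Rightarrow> 'a proj_class \<Rightarrow> 'a proj_class" is dsum
  by (auto simp: idem_iso_def intro: idem_dsum proj_iso_dsum)

instance
proof
  fix a b c :: "'a proj_class"
  show "a + b + c = a + (b + c)"
    by transfer (auto simp: idem_iso_def dsum_assoc intro!: idem_dsum proj_iso_refl)
  show "a + b = b + a"
    by transfer (auto simp: idem_iso_def intro!: idem_dsum proj_iso_dsum_commute)
  show "0 + a = a"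
    by transfer (auto simp: idem_iso_def dsum_empty)
qed

end

abbreviation cls :: "'a::ring_1 mat \<Rightarrow> 'a proj_class" where
  "cls \<equiv> abs_proj_class"

lemma cls_eq_iff:
  assumes "idem_mat e" "idem_mat f"
  shows "cls e = cls f \<longleftrightarrow> proj_iso e f"
proof -
  have "idem_iso e e" "idem_iso f f" using assms by (simp_all add: idem_iso_def proj_iso_refl)
  then have "idem_iso e f \<longleftrightarrow> cls e = cls f"
    using Quotient3_rel[OF Quotient3_proj_class, of e f] by simp
  then show ?thesis using assms by (simp add: idem_iso_def)
qed

lemma cls_cases: obtains e where "idem_mat e" "a = cls e"
proof -
  have "idem_iso (rep_proj_class a) (rep_proj_class a)"
    by (rule Quotient3_rep_reflp[OF Quotient3_proj_class])
  then have "idem_mat (rep_proj_class a)" by (simp only: idem_iso_def)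
  moreover have "a = cls (rep_proj_class a)"
    by (rule Quotient3_abs_rep[OF Quotient3_proj_class, symmetric])
  ultimately show ?thesis by (rule that)
qed

lemma cls_dsum:
  assumes "idem_mat e" "idem_mat f"
  shows "cls (dsum e f) = cls e + cls f"
proof (rule plus_proj_class.abs_eq[symmetric])
  show "idem_iso e e" "idem_iso f f" using assms by (simp_all add: idem_iso_def proj_iso_refl)
qed

lemma cls_zero: "cls (1\<^sub>m 0) = 0"
  by (simp add: zero_proj_class_def)

lemma cls_one: "cls (1\<^sub>m n) = nat_mult n (cls (1\<^sub>m 1))"
proof (induction n)
  case (Suc n)
  have "cls (1\<^sub>m (Suc n)) = cls (dsum (1\<^sub>m 1) (1\<^sub>m n) :: 'a mat)" by (simp add: dsum_one)
  then show ?case using Suc by (simp add: cls_dsum idem_one)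
qed (simp add: cls_zero)

lemma cls_dpow: "idem_mat e \<Longrightarrow> cls (dpow e n) = nat_mult n (cls e)"
  by (induction n) (simp_all add: cls_zero cls_dsum idem_dpow)

text \<open>An isomorphism with the zero module factors \<open>dsum e f\<close> through dimension 0.
  Its entries are then empty sums, so \<open>e\<close> is a zero matrix and itself factors through
  dimension 0.\<close>

lemma proj_class_conical:
  assumes "a + b = (0 :: 'a::ring_1 proj_class)"
  shows "a = 0"
proof -
  obtain e where e: "idem_mat e" "a = cls e" by (rule cls_cases)
  obtain f where f: "idem_mat f" "b = cls f" by (rule cls_cases)
  have iso: "proj_iso (dsum e f) (1\<^sub>m 0)"
    using assms e f by (simp add: cls_dsum[symmetric] cls_zero[symmetric] cls_eq_iff idem_dsum idem_one)
  obtain x y where xy: "x \<in> carrier_mat 0 (dim_row e + dim_row f)"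
    "y \<in> carrier_mat (dim_row e + dim_row f) 0" "y * x = dsum e f"
    by (rule proj_isoE[OF iso idem_dsum[OF e(1) f(1)] idem_one dsum_dim(1) index_one_mat(2)]) (rule that; assumption)
  have "e $$ (i, j) = 0" if "i < dim_row e" "j < dim_col e" for i j
  proof -
    have "e $$ (i, j) = dsum e f $$ (i, j)" using that by (simp add: dsum_def)
    also have "\<dots> = 0" unfolding xy(3)[symmetric] using that xy(1,2) e(1)
      by (auto simp: scalar_prod_def idem_matD)
    finally show ?thesis .
  qed
  then have "e = 0\<^sub>m (dim_row e) 0 * 0\<^sub>m 0 (dim_row e)"
    using e by (intro eq_matI) (auto simp: idem_matD scalar_prod_def)
  then have "proj_iso e (1\<^sub>m 0)"
    by (intro proj_isoI[of _ _ "0\<^sub>m 0 (dim_row e)" "0\<^sub>m (dim_row e) 0"]) 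
       (use e in \<open>auto simp: idem_one\<close>)
  then show ?thesis using e by (simp add: cls_zero[symmetric] cls_eq_iff idem_one)
qed

section \<open>Direct sum decompositions of a free module\<close>

lemma cls_complement:
  assumes e: "idem_mat (e :: 'a::ring_1 mat)" "e \<in> carrier_mat n n"
  shows "cls e + cls (1\<^sub>m n - e) = cls (1\<^sub>m n)"
proof -
  let ?f = "1\<^sub>m n - e"
  note f = idem_complement[OF e]
  have c: "?f \<in> carrier_mat n n" using e by auto
  \<comment> \<open>The block row \<open>(e, 1 - e)\<close> and the corresponding block column; the
    other blocks are empty and only fill the shape of \<open>four_block_mat\<close>.\<close>
  let ?x = "four_block_mat e ?f (0\<^sub>m 0 n) (0\<^sub>m 0 n)"
  let ?y = "four_block_mat e (0\<^sub>m n 0) ?f (0\<^sub>m n 0)"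
  have "?x * ?y = four_block_mat (e + ?f) (0\<^sub>m n 0) (0\<^sub>m 0 n) (0\<^sub>m 0 0)"
    by (subst mult_four_block_mat[of _ n n _ n _ 0 _ _ n _ 0]) (use e f c in \<open>auto simp: idem_matD\<close>)
  also have "\<dots> = 1\<^sub>m n" using e by (intro eq_matI) auto
  finally have xy: "?x * ?y = 1\<^sub>m n" .
  have yx: "?y * ?x = dsum e ?f" unfolding dsum_def
    by (subst mult_four_block_mat[of _ n n _ 0 _ n _ _ n _ n]) (use e f c in \<open>auto simp: idem_matD\<close>)
  have "proj_iso (dsum e ?f) (1\<^sub>m n)"
    by (rule proj_isoI[OF _ _ _ _ yx xy]) (use e f c in \<open>auto intro: idem_dsum idem_one\<close>)
  then show ?thesis using e f by (simp add: cls_dsum[symmetric] cls_eq_iff idem_dsum idem_one)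
qed

lemma cls_of_factorization:
  fixes g :: "'a::ring_1 mat"
  assumes g: "idem_mat g" and dg: "dim_row g = m"
    and v: "v \<in> carrier_mat n m" and w: "w \<in> carrier_mat m n"
    and wv: "w * v = g" and vg: "v * g = v"
  shows "idem_mat (v * w)" "cls (v * w) = cls g"
proof -
  have d: "dim_row v = n" "dim_col v = m" "dim_row w = m" "dim_col w = n"
    using v w by auto
  have "(v * w) * (v * w) = v * (w * v) * w"
    by (simp add: mult_mat_assoc d)
  then have "(v * w) * (v * w) = v * w" by (simp only: wv vg)
  then show i: "idem_mat (v * w)" by (simp add: idem_mat_def d)
  have "proj_iso g (v * w)"
    by (rule proj_isoI[OF g i _ _ wv refl]) (rule carrier_matI; simp add: d dg)+
  then show "cls (v * w) = cls g" by (metis cls_eq_iff[OF g i])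
qed

lemma dsum_empty_right: "dsum a (0\<^sub>m 0 0) = a"
  by (intro eq_matI) (auto simp: dsum_def)

lemma dsum_empty_left: "dsum (0\<^sub>m 0 0) a = a"
  by (intro eq_matI) (auto simp: dsum_def)

text \<open>This is the converse of \<open>cls_complement\<close>: a decomposition in V(R) comes
  from actual complementary idempotents. They are obtained by carrying the two coordinate
  projections of \<open>dsum e f\<close> back along an isomorphism with the free module.\<close>

lemma split_identity:
  assumes "cls (1\<^sub>m n) = a + (b :: 'a::ring_1 proj_class)"
  obtains p where "p \<in> carrier_mat n n" "idem_mat p" "cls p = a" "cls (1\<^sub>m n - p) = b"
proof -
  obtain e where e: "idem_mat e" "a = cls e" by (rule cls_cases)
  obtain f where f: "idem_mat f" "b = cls f" by (rule cls_cases)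
  obtain r s where c: "e \<in> carrier_mat r r" "f \<in> carrier_mat s s"
    using e(1) f(1) by (auto simp: idem_mat_def)
  have d: "dim_row e = r" "dim_col e = r" "dim_row f = s" "dim_col f = s" using c by simp_all
  note ee = idem_matD(2)[OF e(1)] and ff = idem_matD(2)[OF f(1)]
  have iso: "proj_iso (1\<^sub>m n) (dsum e f)"
    using assms e f by (simp add: cls_dsum[symmetric] cls_eq_iff idem_dsum idem_one)
  have dr: "dim_row (dsum e f) = r + s" by (simp add: d)
  obtain x y where xy: "x \<in> carrier_mat (r + s) n" "y \<in> carrier_mat n (r + s)"
    "y * x = 1\<^sub>m n" "x * y = dsum e f" "dsum e f * x = x"
    by (rule proj_isoE[OF iso idem_one idem_dsum[OF e(1) f(1)] index_one_mat(2) dr]) (rule that; assumption)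
  have dx: "dim_row x = r + s" "dim_col x = n" "dim_row y = n" "dim_col y = r + s"
    using xy(1,2) by simp_all
  \<comment> \<open>Here \<open>i\<close> and \<open>j\<close> include and project a summand
    represented by \<open>g\<close>. The transported idempotent factors as
    \<open>(y * i) * (j * x)\<close>, and the reversed product is \<open>g\<close>, which fixes its
    class.\<close>
  have part: "idem_mat (y * (i * j) * x) \<and> cls (y * (i * j) * x) = cls g"
    if g: "idem_mat g" and dg: "dim_row g = m"
      and i: "i \<in> carrier_mat (r + s) m" and j: "j \<in> carrier_mat m (r + s)"
      and ji: "j * i = g" and di: "dsum e f * i = i" and ig: "i * g = i"
    for i j g :: "'a mat" and m
  proof -
    have d': "dim_row i = r + s" "dim_col i = m" "dim_row j = m" "dim_col j = r + s"
      using i j by simp_all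
    have "(j * x) * (y * i) = j * ((x * y) * i)" by (simp add: mult_mat_assoc dx d')
    then have wv: "(j * x) * (y * i) = g" by (simp only: xy(4) di ji)
    have "y * i * g = y * (i * g)" by (intro mult_mat_assoc) (simp_all add: dx d' dg)
    then have vg: "y * i * g = y * i" by (simp only: ig)
    have "y * i \<in> carrier_mat n m" "j * x \<in> carrier_mat m n"
      using i j xy(1,2) by simp_all
    note * = cls_of_factorization[OF g dg this wv vg]
    have "(y * i) * (j * x) = y * (i * j) * x" by (simp add: mult_mat_assoc dx d')
    with * show ?thesis by simp
  qed
  \<comment> \<open>\<open>?E\<close> and \<open>?F\<close> are \<open>e\<close> and
    \<open>f\<close> padded by zeros to the common size. They factor through the unpadded sizes by
    \<open>?i\<close>, \<open>?j\<close> and \<open>?i'\<close>, \<open>?j'\<close>, so the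
    resulting classes are those of \<open>e\<close> and \<open>f\<close>.\<close>
  let ?E = "dsum e (0\<^sub>m s s)" and ?F = "dsum (0\<^sub>m r r) f"
  let ?i = "dsum e (0\<^sub>m s 0)" and ?j = "dsum e (0\<^sub>m 0 s)"
  let ?i' = "dsum (0\<^sub>m r 0) f" and ?j' = "dsum (0\<^sub>m 0 r) f"
  let ?p = "y * ?E * x" and ?q = "y * ?F * x"
  have prods: "?i * ?j = ?E" "?j * ?i = e" "dsum e f * ?i = ?i"
    "?i' * ?j' = ?F" "?j' * ?i' = f" "dsum e f * ?i' = ?i'"
    using c by (simp_all add: dsum_mult d ee ff dsum_empty_right dsum_empty_left)
  have "?i * dsum e (0\<^sub>m 0 0) = ?i" "?i' * dsum (0\<^sub>m 0 0) f = ?i'"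
    by (simp_all add: dsum_mult d ee ff)
  then have absorb: "?i * e = ?i" "?i' * f = ?i'"
    by (simp_all only: dsum_empty_right dsum_empty_left)
  have carr: "?i \<in> carrier_mat (r + s) r" "?j \<in> carrier_mat r (r + s)"
    "?i' \<in> carrier_mat (r + s) s" "?j' \<in> carrier_mat s (r + s)"
    by (rule carrier_matI; simp add: d)+
  have p: "idem_mat ?p" "cls ?p = a"
    using part[OF e(1) d(1) carr(1,2) prods(2,3) absorb(1)] by (simp_all only: prods e(2))
  have q: "cls ?q = b"
    using part[OF f(1) d(3) carr(3,4) prods(5,6) absorb(2)] by (simp only: prods f(2))
  have cE: "?E \<in> carrier_mat (r + s) (r + s)" "?F \<in> carrier_mat (r + s) (r + s)"
    by (rule carrier_matI; simp add: d)+
  \<comment> \<open>The two projections add up to \<open>dsum e f\<close>, which transports to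
    \<open>y * x\<close>, the identity; hence \<open>?q\<close> is the complement of
    \<open>?p\<close>.\<close>
  have "?E + ?F = dsum e f" using c by (simp add: dsum_add)
  moreover have "?p + ?q = y * (?E + ?F) * x"
    using xy(1,2) cE by (simp add: mult_add_distrib_mat[of _ n "r + s" _ "r + s"]
        add_mult_distrib_mat[of _ n "r + s" _ _ n])
  moreover have "y * dsum e f * x = y * (dsum e f * x)"
    by (rule mult_mat_assoc) (simp_all add: dx d)
  ultimately have "?p + ?q = 1\<^sub>m n" by (simp only: xy)
  moreover have "?p + ?q - ?p = ?q" by (intro eq_matI) (auto simp: dx)
  ultimately have "?q = 1\<^sub>m n - ?p" by simp
  with p q show ?thesis by (intro that[of ?p]) (auto simp: dx)
qed

section \<open>Equivalence of regular matrices\<close>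

text \<open>For a quasi-inverse \<open>G\<close> of \<open>D\<close>, the idempotent
  \<open>D * G\<close> projects onto the image of \<open>D\<close>, its complement represents the
  cokernel, and the complement of \<open>G * D\<close> projects onto the kernel.\<close>

definition diagonally_realized ::
    "nat \<Rightarrow> 'a::ring_1 proj_class \<Rightarrow> 'a proj_class \<Rightarrow> 'a proj_class \<Rightarrow> bool" where
  "diagonally_realized n k i c \<longleftrightarrow>
     (\<exists>D G. D \<in> carrier_mat n n \<and> G \<in> carrier_mat n n \<and> diagonal_mat D \<and> D * G * D = D \<and>
        cls (D * G) = i \<and> cls (1\<^sub>m n - D * G) = c \<and> cls (1\<^sub>m n - G * D) = k)"

lemma quasi_inverse_idem:
  assumes "D \<in> carrier_mat n n" "G \<in> carrier_mat n n" "D * G * D = (D :: 'a::ring_1 mat)"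
  shows "idem_mat (D * G)" "idem_mat (G * D)" "proj_iso (D * G) (G * D)"
proof -
  have d: "dim_row D = n" "dim_col D = n" "dim_row G = n" "dim_col G = n" using assms by auto
  have a: "D * (G * D) = D" using assms by (simp add: mult_mat_assoc d)
  have a': "D * (G * (D * X)) = D * X" if "dim_row X = n" for X
    using assms(3) that by (simp flip: mult_mat_assoc add: d)
  show 1: "idem_mat (D * G)" "idem_mat (G * D)"
    using a a' by (simp_all add: idem_mat_def d mult_mat_assoc)
  \<comment> \<open>\<open>G * D * G = G\<close> is not assumed, so the inverse of \<open>D\<close>
    between the two summands is taken to be \<open>G * (D * G)\<close>.\<close>
  show "proj_iso (D * G) (G * D)"
    by (rule proj_isoI[OF 1, of "G * (D * G)" D]) (simp_all add: d mult_mat_assoc a a', use d in auto)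
qed

text \<open>Both decompositions of R are realized by idempotents \<open>p\<close> and
  \<open>q\<close> of class \<open>i\<close>. An isomorphism \<open>x\<close> between their images,
  with inverse \<open>y\<close>, is the required entry: \<open>y * x = p\<close> has complement of
  class \<open>k\<close>, and \<open>x * y = q\<close> has complement of class
  \<open>c\<close>.\<close>

lemma diagonally_realized_1:
  assumes "cls (1\<^sub>m 1) = k + i" "cls (1\<^sub>m 1) = i + c"
  shows "diagonally_realized 1 k i c"
proof -
  obtain p where p: "p \<in> carrier_mat 1 1" "idem_mat p" "cls p = i" "cls (1\<^sub>m 1 - p) = k"
    using split_identity[of 1 i k] assms(1) by (auto simp: add.commute)
  obtain q where q: "q \<in> carrier_mat 1 1" "idem_mat q" "cls q = i" "cls (1\<^sub>m 1 - q) = c"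
    using split_identity[of 1 i c] assms(2) by auto
  have iso: "proj_iso p q" using p q by (simp flip: cls_eq_iff)
  have dims: "dim_row p = 1" "dim_row q = 1" using p(1) q(1) by auto
  obtain x y where "x \<in> carrier_mat 1 1" "y \<in> carrier_mat 1 1" "y * x = p" "x * y = q" "q * x = x"
    by (rule proj_isoE[OF iso p(2) q(2) dims]) (rule that; assumption)
  then show ?thesis unfolding diagonally_realized_def
    using p q by - (rule exI[of _ x], rule exI[of _ y], auto simp: diagonal_mat_def)
qed

lemma diagonally_realized_add:
  assumes "diagonally_realized m k i c" "diagonally_realized n k' i' c'"
  shows "diagonally_realized (m + n) (k + k') (i + i') (c + c')"
proof -
  obtain D G where 1: "D \<in> carrier_mat m m" "G \<in> carrier_mat m m" "diagonal_mat D" "D * G * D = D"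
    "cls (D * G) = i" "cls (1\<^sub>m m - D * G) = c" "cls (1\<^sub>m m - G * D) = k"
    using assms(1) unfolding diagonally_realized_def by blast
  obtain D' G' where 2: "D' \<in> carrier_mat n n" "G' \<in> carrier_mat n n" "diagonal_mat D'" "D' * G' * D' = D'"
    "cls (D' * G') = i'" "cls (1\<^sub>m n - D' * G') = c'" "cls (1\<^sub>m n - G' * D') = k'"
    using assms(2) unfolding diagonally_realized_def by blast
  note i = quasi_inverse_idem[OF 1(1,2,4)] quasi_inverse_idem[OF 2(1,2,4)]
  have d: "dim_row D = m" "dim_col D = m" "dim_row G = m" "dim_col G = m"
    "dim_row D' = n" "dim_col D' = n" "dim_row G' = n" "dim_col G' = n" using 1 2 by auto
  have c: "D * G \<in> carrier_mat m m" "G * D \<in> carrier_mat m m"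
    "D' * G' \<in> carrier_mat n n" "G' * D' \<in> carrier_mat n n" using 1 2 by auto
  have m: "1\<^sub>m (m + n) - dsum a b = dsum (1\<^sub>m m - a) (1\<^sub>m n - b)"
    if "a \<in> carrier_mat m m" "b \<in> carrier_mat n n" for a b :: "'a mat"
    using that by (simp flip: dsum_one add: dsum_minus)
  show ?thesis unfolding diagonally_realized_def
  proof (rule exI[of _ "dsum D D'"], rule exI[of _ "dsum G G'"], intro conjI)
    show "diagonal_mat (dsum D D')" using 1 2 by (intro dsum_diagonal) auto
    show "cls (dsum D D' * dsum G G') = i + i'"
      using 1 2 i by (simp add: dsum_mult d cls_dsum)
    show "cls (1\<^sub>m (m + n) - dsum D D' * dsum G G') = c + c'"
      "cls (1\<^sub>m (m + n) - dsum G G' * dsum D D') = k + k'"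
      using 1 2 i c by (simp_all add: dsum_mult d m cls_dsum idem_complement)
    show "dsum D D' * dsum G G' * dsum D D' = dsum D D'"
      using 1 2 by (simp add: dsum_mult d)
  qed (use d in auto)
qed

lemma splits_diagonally_realized:
  "splits_diagonally n (cls (1\<^sub>m 1)) k i c \<Longrightarrow> n \<ge> 1 \<Longrightarrow> diagonally_realized n k i c"
proof (induction n arbitrary: k i c)
  case (Suc n)
  then obtain k1 i1 c1 k' i' c' where 1: "cls (1\<^sub>m 1) = k1 + i1" "cls (1\<^sub>m 1) = i1 + c1"
    "k = k1 + k'" "i = i1 + i'" "c = c1 + c'" "splits_diagonally n (cls (1\<^sub>m 1)) k' i' c'"
    unfolding splits_diagonally.simps by blast
  have r: "diagonally_realized 1 k1 i1 c1" using 1 by (intro diagonally_realized_1)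
  show ?case
  proof (cases "n = 0")
    case True
    then show ?thesis using 1 r by simp
  next
    case False
    then have "diagonally_realized n k' i' c'" using Suc.IH 1(6) by simp
    from diagonally_realized_add[OF r this] show ?thesis using 1 by simp
  qed
qed simp

text \<open>Isomorphisms of images and cokernels glue to an automorphism \<open>P\<close> of the
  target, those of images and kernels to an automorphism \<open>Q\<close> of the source, and the two
  are matched on the image so that they carry \<open>A\<close> to \<open>D\<close>.\<close>

lemma regular_equivalent:
  fixes A D :: "'a::ring_1 mat"
  assumes A: "A \<in> carrier_mat n n" "B \<in> carrier_mat n n" "A * B * A = A"
    and D: "D \<in> carrier_mat n n" "G \<in> carrier_mat n n" "D * G * D = D"
    and image: "cls (A * B) = cls (D * G)"
    and coker: "cls (1\<^sub>m n - A * B) = cls (1\<^sub>m n - D * G)"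
    and kernel: "cls (1\<^sub>m n - B * A) = cls (1\<^sub>m n - G * D)"
  obtains P Q where "P \<in> carrier_mat n n" "Q \<in> carrier_mat n n" "invertible_mat P" "invertible_mat Q"
    "P * A * Q = D"
proof -
  note iA = quasi_inverse_idem[OF A] and iD = quasi_inverse_idem[OF D]
  have c: "A * B \<in> carrier_mat n n" "B * A \<in> carrier_mat n n" "D * G \<in> carrier_mat n n" "G * D \<in> carrier_mat n n"
    using A D by auto
  note cA = idem_complement[OF iA(1) c(1)] and cA' = idem_complement[OF iA(2) c(2)]
    and cD = idem_complement[OF iD(1) c(3)] and cD' = idem_complement[OF iD(2) c(4)]
  let ?z = "0\<^sub>m n n :: 'a mat"
  obtain x y where x: "x \<in> carrier_mat n n" "y \<in> carrier_mat n n" "y * x = A * B" "x * y = D * G"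
    "(D * G) * x = x" "x * (A * B) = x" "(A * B) * y = y" "y * (D * G) = y"
  proof -
    have iso: "proj_iso (A * B) (D * G)" using image iA iD by (simp add: cls_eq_iff)
    have "dim_row (A * B) = n" "dim_row (D * G) = n" using c by auto
    then show ?thesis by (rule proj_isoE[OF iso iA(1) iD(1)]) (rule that)
  qed
  obtain x' y' where x': "x' \<in> carrier_mat n n" "y' \<in> carrier_mat n n"
    "y' * x' = 1\<^sub>m n - A * B" "x' * y' = 1\<^sub>m n - D * G"
    "(1\<^sub>m n - D * G) * x' = x'" "x' * (1\<^sub>m n - A * B) = x'" "(1\<^sub>m n - A * B) * y' = y'" "y' * (1\<^sub>m n - D * G) = y'"
  proof -
    have iso: "proj_iso (1\<^sub>m n - A * B) (1\<^sub>m n - D * G)" using coker cA cD by (simp add: cls_eq_iff)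
    have "dim_row (1\<^sub>m n - A * B) = n" "dim_row (1\<^sub>m n - D * G) = n" using c by auto
    then show ?thesis by (rule proj_isoE[OF iso cA(3) cD(3)]) (rule that)
  qed
  obtain v w where v: "v \<in> carrier_mat n n" "w \<in> carrier_mat n n"
    "w * v = 1\<^sub>m n - B * A" "v * w = 1\<^sub>m n - G * D"
    "(1\<^sub>m n - G * D) * v = v" "v * (1\<^sub>m n - B * A) = v" "(1\<^sub>m n - B * A) * w = w" "w * (1\<^sub>m n - G * D) = w"
  proof -
    have iso: "proj_iso (1\<^sub>m n - B * A) (1\<^sub>m n - G * D)" using kernel cA' cD' by (simp add: cls_eq_iff)
    have "dim_row (1\<^sub>m n - B * A) = n" "dim_row (1\<^sub>m n - G * D) = n" using c by auto
    then show ?thesis by (rule proj_isoE[OF iso cA'(3) cD'(3)]) (rule that)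
  qed
  have dims: "dim_row M = n \<and> dim_col M = n" if "M \<in> {A, B, D, G, x, y, x', y', v, w}" for M
    using that A D x(1,2) x'(1,2) v(1,2) by auto
  note d = dims[THEN conjunct1] dims[THEN conjunct2]
  \<comment> \<open>Maps composed through complementary summands vanish, because
    \<open>e * (1 - e)\<close> and \<open>(1 - e) * e\<close> are zero.\<close>
  have orth: "M * N = ?z"
    if "M * e = M" "(1\<^sub>m n - e) * N = N" "idem_mat e" "e \<in> carrier_mat n n" "M \<in> carrier_mat n n" "N \<in> carrier_mat n n"
    for M N e :: "'a mat"
  proof -
    have "M * N = (M * e) * ((1\<^sub>m n - e) * N)" using that by simp
    also have "\<dots> = M * ((e * (1\<^sub>m n - e)) * N)"
      using that(4-6) by (simp add: mult_mat_assoc)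
    finally show ?thesis using that by (simp add: idem_complement)
  qed
  have orth': "M * N = ?z"
    if "M * (1\<^sub>m n - e) = M" "e * N = N" "idem_mat e" "e \<in> carrier_mat n n" "M \<in> carrier_mat n n" "N \<in> carrier_mat n n"
    for M N e :: "'a mat"
  proof -
    have "M * N = (M * (1\<^sub>m n - e)) * (e * N)" using that by simp
    also have "\<dots> = M * (((1\<^sub>m n - e) * e) * N)"
      using that(4-6) by (simp add: mult_mat_assoc)
    finally show ?thesis using that by (simp add: idem_complement)
  qed
  have comp: "(e + ?z) + (?z + (1\<^sub>m n - e)) = 1\<^sub>m n" if "e \<in> carrier_mat n n" for e :: "'a mat"
    using that by (intro eq_matI) auto
  have expand: "(a + b) * (a' + b') = (a * a' + b * a') + (a * b' + b * b')"
    if "a \<in> carrier_mat n n" "b \<in> carrier_mat n n" "a' \<in> carrier_mat n n" "b' \<in> carrier_mat n n"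
    for a b a' b' :: "'a mat"
    using that by (simp add: add_mult_distrib_mat[of _ n n _ _ n] mult_add_distrib_mat[of _ n n _ n])
  \<comment> \<open>Gluing: \<open>a\<close> and \<open>b\<close> match the two summands of one
    decomposition of the free module with those of another, and \<open>a' + b'\<close> is the
    inverse of \<open>a + b\<close>.\<close>
  have invertible: "invertible_mat (a + b)"
    if "a \<in> carrier_mat n n" "b \<in> carrier_mat n n" "a' \<in> carrier_mat n n" "b' \<in> carrier_mat n n"
      "a * a' = e" "b * b' = 1\<^sub>m n - e" "a * b' = ?z" "b * a' = ?z"
      "a' * a = f" "b' * b = 1\<^sub>m n - f" "a' * b = ?z" "b' * a = ?z"
      "e \<in> carrier_mat n n" "f \<in> carrier_mat n n"
    for a b a' b' e f :: "'a mat"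
  proof -
    have "(a + b) * (a' + b') = 1\<^sub>m n" "(a' + b') * (a + b) = 1\<^sub>m n"
      by (simp_all only: expand[OF that(1-4)] expand[OF that(3,4,1,2)] that(5-12) comp[OF that(13)] comp[OF that(14)])
    then show ?thesis using that(1-4) by (auto simp: invertible_mat_def inverts_mat_def)
  qed
  \<comment> \<open>On the source, the complement of the kernel is identified with the image:
    \<open>B * y * D\<close> applies \<open>D\<close>, crosses to the image of \<open>A\<close> by
    \<open>y\<close>, and returns by \<open>B\<close>. The matrix \<open>w\<close> matches the
    kernels. \<open>?R\<close> is the reverse passage, so \<open>?R + v\<close> inverts
    \<open>?Q\<close>.\<close>
  let ?P = "x + x'" and ?Q = "B * y * D + w" and ?R = "G * x * A"
  have c3: "B * y * D \<in> carrier_mat n n" "?R \<in> carrier_mat n n" using A D x by auto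
  have AB: "A * (B * A) = A" and DG: "D * (G * D) = D" using A D by simp_all
  have P: "invertible_mat ?P"
    by (rule invertible[OF x(1) x'(1) x(2) x'(2) x(4) x'(4) _ _ x(3) x'(3) _ _ c(3,1)])
      (intro orth[of _ "A * B"] orth'[of _ "A * B"] orth[of _ "D * G"] orth'[of _ "D * G"]; 
        (fact x x' iA iD c))+
  have Dv: "D * v = ?z" by (rule orth[of _ "G * D"]) (fact DG v iD c D)+
  have Aw: "A * w = ?z" by (rule orth[of _ "B * A"]) (fact AB v iA c A)+
  have wR: "w * ?R = ?z"
  proof (rule orth'[of _ "G * D"])
    have "G * D * (G * x * A) = G * ((D * G) * x) * A"
      using A D x(1) by (simp add: mult_mat_assoc)
    then show "G * D * (G * x * A) = G * x * A" by (simp add: x)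
  qed (fact v iD c c3)+
  have vB: "v * (B * y * D) = ?z"
  proof (rule orth'[of _ "B * A"])
    have "B * A * (B * y * D) = B * ((A * B) * y) * D"
      using A D x(2) by (simp add: mult_mat_assoc)
    then show "B * A * (B * y * D) = B * y * D" by (simp add: x)
  qed (fact v iA c c3)+
  have Q: "invertible_mat ?Q"
  proof (rule invertible[OF c3(1) v(2) c3(2) v(1) _ v(3) _ wR _ v(4) _ vB c(2,4)])
    have "(B * y * D) * ?R = B * (y * (D * G)) * x * A"
      using A D x(1,2) by (simp add: mult_mat_assoc)
    also have "\<dots> = B * (y * x) * A" using A x(1,2) by (simp add: x(8) mult_mat_assoc)
    also have "\<dots> = B * (A * B * A)" using A by (simp add: x(3) mult_mat_assoc)
    finally show "(B * y * D) * ?R = B * A" using A by simp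
    have "?R * (B * y * D) = G * (x * (A * B)) * y * D"
      using A D x(1,2) by (simp add: mult_mat_assoc)
    also have "\<dots> = G * (x * y) * D" using D x(1,2) by (simp add: x(6) mult_mat_assoc)
    also have "\<dots> = G * (D * G * D)" using D by (simp add: x(4) mult_mat_assoc)
    finally show "?R * (B * y * D) = G * D" using D by simp
    have "B * y * D * v = B * y * (D * v)" using A D x(2) v(1) by (simp add: mult_mat_assoc)
    then show "B * y * D * v = ?z" using A x(2) by (simp add: Dv)
    have "?R * w = G * x * (A * w)" using A D x(1) v(2) by (simp add: mult_mat_assoc)
    then show "?R * w = ?z" using D x(1) by (simp add: Aw)
  qed
  have x'y: "x' * y = ?z" by (rule orth'[of _ "A * B"]) (fact x x' iA c)+
  \<comment> \<open>The kernel part dies because \<open>A * w\<close> is zero, and the cokernel part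
    because \<open>x' * y\<close> is zero. What survives is
    \<open>x * y * D = D * G * D = D\<close>.\<close>
  have "?P * A * ?Q = ?P * (A * (B * y * D) + A * w)"
    using A x x' v c3 by (simp add: mult_mat_assoc mult_add_distrib_mat[of _ n n _ n])
  also have "A * (B * y * D) = ((A * B) * y) * D" using A D x(2) by (simp add: mult_mat_assoc)
  also have "\<dots> = y * D" by (simp add: x)
  also have "?P * (y * D + A * w) = x * (y * D) + x' * (y * D)"
    using A D x(1,2) x'(1) by (simp add: Aw add_mult_distrib_mat[of _ n n _ _ n])
  also have "\<dots> = (x * y) * D + (x' * y) * D" using D x(1,2) x'(1) by (simp add: mult_mat_assoc)
  also have "\<dots> = D" using D by (simp add: x(4) x'y)
  finally have "?P * A * ?Q = D" .
  then show ?thesis using that[of ?P ?Q] P Q x(1) x'(1) v(2) c3 by auto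
qed

section \<open>Passage between modules and their classes in V(R)\<close>

lemma proj_class_refinement_monoid:
  assumes ref: "refinement_ring TYPE('a::ring_1)"
    and canc: "\<And>a b :: 'a mat. idem_mat a \<Longrightarrow> idem_mat b \<Longrightarrow> is_generator b \<Longrightarrow>
           proj_iso (dsum (free_mod 2) a) (dsum (free_mod 1) b) \<Longrightarrow>
           proj_iso (dsum (free_mod 1) a) b"
  shows "refinement_monoid (cls (1\<^sub>m 1 :: 'a mat))"
proof
  fix a b c d :: "'a proj_class"
  assume eq: "a + b = c + d"
  obtain x1 where a: "idem_mat x1" "a = cls x1" by (rule cls_cases)
  obtain x2 where b: "idem_mat x2" "b = cls x2" by (rule cls_cases)
  obtain y1 where c: "idem_mat y1" "c = cls y1" by (rule cls_cases)
  obtain y2 where d: "idem_mat y2" "d = cls y2" by (rule cls_cases)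
  have "proj_iso (dsum x1 x2) (dsum y1 y2)"
    using eq a b c d by (simp add: cls_dsum[symmetric] cls_eq_iff idem_dsum)
  then obtain z11 z12 z21 z22 where z: "idem_mat z11" "idem_mat z12" "idem_mat z21" "idem_mat z22"
    "proj_iso x1 (dsum z11 z12)" "proj_iso x2 (dsum z21 z22)"
    "proj_iso y1 (dsum z11 z21)" "proj_iso y2 (dsum z12 z22)"
    using ref a(1) b(1) c(1) d(1) unfolding refinement_ring_def by blast
  show "\<exists>z11 z12 z21 z22. a = z11 + z12 \<and> b = z21 + z22 \<and> c = z11 + z21 \<and> d = z12 + z22"
    using a b c d z
    by - (rule exI[of _ "cls z11"], rule exI[of _ "cls z12"], rule exI[of _ "cls z21"],
        rule exI[of _ "cls z22"], simp add: cls_dsum[symmetric] cls_eq_iff idem_dsum)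
next
  fix a b :: "'a proj_class"
  assume "a + b = 0"
  then show "a = 0" by (rule proj_class_conical)
next
  fix e a b :: "'a proj_class" and k
  let ?u = "cls (1\<^sub>m 1 :: 'a mat)"
  assume gen: "?u + e = nat_mult k b" and eq: "?u + (?u + a) = ?u + b"
  obtain e' where e: "idem_mat e'" "e = cls e'" by (rule cls_cases)
  obtain a' where a: "idem_mat a'" "a = cls a'" by (rule cls_cases)
  obtain b' where b: "idem_mat b'" "b = cls b'" by (rule cls_cases)
  have two: "cls (free_mod 2) = ?u + ?u" using cls_one[of 2] by (simp add: numeral_2_eq_2)
  \<comment> \<open>Read on representatives, the equation \<open>gen\<close> provides the complement
    and the multiple demanded by \<open>is_generator\<close>.\<close>
  have "proj_iso (dsum (free_mod 1) e') (dpow b' k)"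
    using gen e b by (simp add: cls_eq_iff[symmetric] cls_dsum cls_dpow idem_dsum idem_dpow idem_one)
  then have "is_generator b'" unfolding is_generator_def using e by blast
  moreover have "proj_iso (dsum (free_mod 2) a') (dsum (free_mod 1) b')"
    using eq a b
    by (simp add: cls_eq_iff[symmetric] cls_dsum idem_dsum idem_one two add.assoc)
  ultimately have "proj_iso (dsum (free_mod 1) a') b'" using canc a b by blast
  then show "?u + a = b"
    using a b by (simp add: cls_eq_iff[symmetric] cls_dsum idem_dsum idem_one)
qed

theorem theorem3p4:
  assumes "refinement_ring TYPE('a::ring_1)"
    and "\<And>a b :: 'a mat. idem_mat a \<Longrightarrow> idem_mat b \<Longrightarrow> is_generator b \<Longrightarrow>
           proj_iso (dsum (free_mod 2) a) (dsum (free_mod 1) b) \<Longrightarrow>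
           proj_iso (dsum (free_mod 1) a) b"
    and "(A :: 'a mat) \<in> carrier_mat n n"
    and "regular_mat A"
  shows "admits_diagonal_reduction A"
proof (cases n)
  \<comment> \<open>The splitting and its realization both need at least one diagonal entry; an
    empty matrix is already diagonal.\<close>
  case 0
  then show ?thesis unfolding admits_diagonal_reduction_def using assms(3)
    by (intro exI[of _ "1\<^sub>m 0"])
       (auto simp: diagonal_mat_def invertible_mat_def inverts_mat_def intro!: exI[of _ "1\<^sub>m 0"])
next
  case (Suc m)
  note A = assms(3)
  obtain B where B: "B \<in> carrier_mat n n" "A * B * A = A"
    using assms(3,4) unfolding regular_mat_def by auto
  note i = quasi_inverse_idem[OF A B]
  let ?u = "cls (1\<^sub>m 1 :: 'a mat)"
  interpret refinement_monoid ?u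
    using proj_class_refinement_monoid[OF assms(1,2)] .
  have c: "A * B \<in> carrier_mat n n" "B * A \<in> carrier_mat n n" using A B by auto
  \<comment> \<open>The complement of the kernel, represented by \<open>B * A\<close>, is isomorphic
    to the image, so the same class \<open>i\<close> occurs in both decompositions of the free
    module.\<close>
  have "cls (A * B) = cls (B * A)" using i by (simp add: cls_eq_iff)
  then have "nat_mult n ?u = cls (1\<^sub>m n - B * A) + cls (A * B)"
    unfolding cls_one[symmetric] using cls_complement[OF i(2) c(2)] by (simp add: add.commute)
  moreover have "nat_mult n ?u = cls (A * B) + cls (1\<^sub>m n - A * B)"
    unfolding cls_one[symmetric] using cls_complement[OF i(1) c(1)] by simp
  ultimately have "splits_diagonally n ?u (cls (1\<^sub>m n - B * A)) (cls (A * B)) (cls (1\<^sub>m n - A * B))"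
    unfolding Suc by (rule splits_diagonally)
  then have "diagonally_realized n (cls (1\<^sub>m n - B * A)) (cls (A * B)) (cls (1\<^sub>m n - A * B))"
    by (rule splits_diagonally_realized) (simp add: Suc)
  then obtain D G where D: "D \<in> carrier_mat n n" "G \<in> carrier_mat n n" "diagonal_mat D" "D * G * D = D"
    "cls (D * G) = cls (A * B)" "cls (1\<^sub>m n - D * G) = cls (1\<^sub>m n - A * B)"
    "cls (1\<^sub>m n - G * D) = cls (1\<^sub>m n - B * A)"
    unfolding diagonally_realized_def by blast
  obtain P Q where "P \<in> carrier_mat n n" "Q \<in> carrier_mat n n" "invertible_mat P" "invertible_mat Q"
    "P * A * Q = D"
    using regular_equivalent[OF A B D(1,2,4) D(5-7)[symmetric]] .
  then show ?thesis unfolding admits_diagonal_reduction_def using A D(3)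
    by - (rule exI[of _ P], rule exI[of _ Q], simp)
qed

end
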